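(* Let $\mathbb{K}$ be a field of characteristic zero and let $\mathcal{D}\subset\mathbb{Z}_+^3$ be a three-dimensional Ferrers diagram which satisfies the projection property. Then $\mathbf{I}_2(\mathcal{D})$ is a prime ideal in $\mathbb{K}[\mathbf{T}_{\mathcal{D}}]$.
   Context: $\mathbb{Z}_+$ denotes the positive integers. A three-dimensional Ferrers diagram is a finite nonempty set $\mathcal{D}\subset\mathbb{Z}_+^3$ such that whenever $(i_0,j_0,k_0)\in\mathcal{D}$ and $i\le i_0$, $j\le j_0$, $k\le k_0$ are positive integers, then $(i,j,k)\in\mathcal{D}$. Let $a_{\mathcal{D}}$ be the number of distinct first coordinates of points of $\mathcal{D}$. $\mathcal{D}$ satisfies the projection property if for every $2\le i\le a_{\mathcal{D}}$ one has $(i-1,b_i,c_i)\in\mathcal{D}$, where $b_i=\max\{j:(i,j,1)\in\mathcal{D}\}$ and $c_i=\max\{k:(i,1,k)\in\mathcal{D}\}$. Let $\mathbb{K}[\mathbf{T}_{\mathcal{D}}]=\mathbb{K}[T_{\boldsymbol u}:\boldsymbol u\in\mathcal{D}]$. For $\boldsymbol u=(i_1,j_1,k_1)$, $\boldsymbol v=(i_2,j_2,k_2)$ in $\mathcal{D}$ put $\mathbf{I}_{2,x}(\boldsymbol u,\boldsymbol v)=T_{\boldsymbol u}T_{\boldsymbol v}-T_{i_2,j_1,k_1}T_{i_1,j_2,k_2}$ if both $(i_2,j_1,k_1),(i_1,j_2,k_2)\in\mathcal{D}$, and $0$ otherwise; $\mathbf{I}_{2,y}$ and $\mathbf{I}_{2,z}$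 are defined analogously by switching the second, respectively third, coordinates. The 2-minors ideal $\mathbf{I}_2(\mathcal{D})\subset\mathbb{K}[\mathbf{T}_{\mathcal{D}}]$ is generated by all $\mathbf{I}_{2,x}(\boldsymbol u,\boldsymbol v),\mathbf{I}_{2,y}(\boldsymbol u,\boldsymbol v),\mathbf{I}_{2,z}(\boldsymbol u,\boldsymbol v)$ with $\boldsymbol u,\boldsymbol v\in\mathcal{D}$. *)

theory Defs
  imports "HOL-Library.Poly_Mapping" "HOL-Algebra.Ideal"
begin

type_synonym point = "nat \<times> nat \<times> nat"

definition ferrers_diagram :: "point set \<Rightarrow> bool" where
  "ferrers_diagram D \<longleftrightarrow>
     finite D \<and> D \<noteq> {} \<and> (\<forall>(i, j, k)\<in>D. 1 \<le> i \<and> 1 \<le> j \<and> 1 \<le> k) \<and>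
     (\<forall>i0 j0 k0 i j k. (i0, j0, k0) \<in> D \<and> 1 \<le> i \<and> i \<le> i0 \<and> 1 \<le> j \<and> j \<le> j0 \<and> 1 \<le> k \<and> k \<le> k0
        \<longrightarrow> (i, j, k) \<in> D)"

definition a_dim :: "point set \<Rightarrow> nat" where
  "a_dim D = card (fst ` D)"

definition b_dim :: "point set \<Rightarrow> nat \<Rightarrow> nat" where
  "b_dim D i = Max {j. (i, j, 1) \<in> D}"

definition c_dim :: "point set \<Rightarrow> nat \<Rightarrow> nat" where
  "c_dim D i = Max {k. (i, 1, k) \<in> D}"

definition projection_property :: "point set \<Rightarrow> bool" where
  "projection_property D \<longleftrightarrow>
     (\<forall>i. 2 \<le> i \<and> i \<le> a_dim D \<longrightarrow> (i - 1, b_dim D i, c_dim D i) \<in> D)"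

text \<open>A polynomial is a finitely supported function from monomials to coefficients, and a
  monomial is a finitely supported function from variables to exponents. The type
  \<^typ>\<open>('v \<Rightarrow>\<^sub>0 nat) \<Rightarrow>\<^sub>0 'k\<close> has all elements of \<^typ>\<open>'v\<close> as variables; the ring below is its
  subring of the polynomials in which only variables from \<open>V\<close> occur.\<close>

type_synonym ('v, 'k) mpoly = "('v \<Rightarrow>\<^sub>0 nat) \<Rightarrow>\<^sub>0 'k"

definition mpoly_ring :: "'v set \<Rightarrow> ('v, 'k::field) mpoly ring" where
  "mpoly_ring V = \<lparr>carrier = {p. \<forall>m\<in>Poly_Mapping.keys p. Poly_Mapping.keys m \<subseteq> V},
     monoid.mult = (*), one = 1, ring.zero = 0, add = (+)\<rparr>"

definition Var :: "'v \<Rightarrow> ('v, 'k::field) mpoly" where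
  "Var u = Poly_Mapping.single (Poly_Mapping.single u 1) 1"

fun I2x :: "point set \<Rightarrow> point \<Rightarrow> point \<Rightarrow> (point, 'k::field) mpoly" where
  "I2x D (i1, j1, k1) (i2, j2, k2) =
     (if (i2, j1, k1) \<in> D \<and> (i1, j2, k2) \<in> D
      then Var (i1, j1, k1) * Var (i2, j2, k2) - Var (i2, j1, k1) * Var (i1, j2, k2) else 0)"

fun I2y :: "point set \<Rightarrow> point \<Rightarrow> point \<Rightarrow> (point, 'k::field) mpoly" where
  "I2y D (i1, j1, k1) (i2, j2, k2) =
     (if (i1, j2, k1) \<in> D \<and> (i2, j1, k2) \<in> D
      then Var (i1, j1, k1) * Var (i2, j2, k2) - Var (i1, j2, k1) * Var (i2, j1, k2) else 0)"

fun I2z :: "point set \<Rightarrow> point \<Rightarrow> point \<Rightarrow> (point, 'k::field) mpoly" where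
  "I2z D (i1, j1, k1) (i2, j2, k2) =
     (if (i1, j1, k2) \<in> D \<and> (i2, j2, k1) \<in> D
      then Var (i1, j1, k1) * Var (i2, j2, k2) - Var (i1, j1, k2) * Var (i2, j2, k1) else 0)"

definition minors_gens :: "point set \<Rightarrow> (point, 'k::field) mpoly set" where
  "minors_gens D = (\<Union>u\<in>D. \<Union>v\<in>D. {I2x D u v, I2y D u v, I2z D u v})"

definition minors_ideal :: "point set \<Rightarrow> (point, 'k::field) mpoly set" where
  "minors_ideal D = Idl\<^bsub>mpoly_ring D\<^esub> (minors_gens D)"

lemma mpoly_ring_simps [simp]:
  "p \<in> carrier (mpoly_ring V) \<longleftrightarrow> (\<forall>m\<in>Poly_Mapping.keys p. Poly_Mapping.keys m \<subseteq> V)"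
  "p \<otimes>\<^bsub>mpoly_ring V\<^esub> q = p * q"
  "p \<oplus>\<^bsub>mpoly_ring V\<^esub> q = p + q"
  "\<one>\<^bsub>mpoly_ring V\<^esub> = 1"
  "\<zero>\<^bsub>mpoly_ring V\<^esub> = 0"
  by (simp_all add: mpoly_ring_def)

lemma mpoly_mult_closed:
  assumes "p \<in> carrier (mpoly_ring V)" "q \<in> carrier (mpoly_ring V)"
  shows "p * q \<in> carrier (mpoly_ring V)"
proof -
  have "Poly_Mapping.keys m \<subseteq> V" if m: "m \<in> Poly_Mapping.keys (p * q)" for m
  proof -
    obtain a b where "m = a + b" "a \<in> Poly_Mapping.keys p" "b \<in> Poly_Mapping.keys q"
      using m keys_mult[of p q] by blast
    then show ?thesis using assms Poly_Mapping.keys_add[of a b] by fastforce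
  qed
  then show ?thesis by simp
qed

lemma mpoly_add_closed:
  assumes "p \<in> carrier (mpoly_ring V)" "q \<in> carrier (mpoly_ring V)"
  shows "p + q \<in> carrier (mpoly_ring V)"
  using assms Poly_Mapping.keys_add[of p q] by fastforce

lemma mpoly_diff_closed:
  assumes "p \<in> carrier (mpoly_ring V)" "q \<in> carrier (mpoly_ring V)"
  shows "p - q \<in> carrier (mpoly_ring V)"
  using assms keys_diff[of p q] by fastforce

lemma cring_mpoly_ring: "cring (mpoly_ring V :: ('v, 'k::field) mpoly ring)"
proof (rule cringI)
  show "abelian_group (mpoly_ring V :: ('v, 'k) mpoly ring)"
  proof (rule abelian_groupI)
    fix x :: "('v, 'k) mpoly"
    assume x: "x \<in> carrier (mpoly_ring V)"
    have "- x \<in> carrier (mpoly_ring V)" using x by simp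
    then show "\<exists>y\<in>carrier (mpoly_ring V). y \<oplus>\<^bsub>mpoly_ring V\<^esub> x = \<zero>\<^bsub>mpoly_ring V\<^esub>"
      by (intro bexI[of _ "- x"]) simp
  next
    fix x y :: "('v, 'k) mpoly"
    assume "x \<in> carrier (mpoly_ring V)" "y \<in> carrier (mpoly_ring V)"
    then show "x \<oplus>\<^bsub>mpoly_ring V\<^esub> y \<in> carrier (mpoly_ring V)"
      unfolding mpoly_ring_simps(3) by (rule mpoly_add_closed)
  qed (simp_all add: ac_simps)
  show "Group.comm_monoid (mpoly_ring V :: ('v, 'k) mpoly ring)"
  proof (rule comm_monoidI)
    fix x y :: "('v, 'k) mpoly"
    assume "x \<in> carrier (mpoly_ring V)" "y \<in> carrier (mpoly_ring V)"
    then show "x \<otimes>\<^bsub>mpoly_ring V\<^esub> y \<in> carrier (mpoly_ring V)"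
      unfolding mpoly_ring_simps(2) by (rule mpoly_mult_closed)
  qed (simp_all add: ac_simps)
qed (simp add: algebra_simps)

lemma Var_closed: "u \<in> V \<Longrightarrow> Var u \<in> carrier (mpoly_ring V)"
  by (simp add: Var_def)

lemma minors_gens_subset: "minors_gens D \<subseteq> carrier (mpoly_ring D)"
proof -
  have 0: "0 \<in> carrier (mpoly_ring D)" by simp
  have "I2x D u v \<in> carrier (mpoly_ring D)" "I2y D u v \<in> carrier (mpoly_ring D)"
       "I2z D u v \<in> carrier (mpoly_ring D)" if "u \<in> D" "v \<in> D" for u v
    using that
    by (cases u; cases v; simp del: mpoly_ring_simps(1);
        intro impI conjI 0 mpoly_diff_closed mpoly_mult_closed Var_closed; simp)+
  then show ?thesis unfolding minors_gens_def by blast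
qed

text \<open>Hence \<^const>\<open>minors_ideal\<close> is the ideal generated by the minors, and not the intersection
  over an empty family.\<close>

lemma ideal_minors_ideal: "ideal (minors_ideal D) (mpoly_ring D)"
  unfolding minors_ideal_def
  by (intro ring.genideal_ideal cring.axioms(1) cring_mpoly_ring minors_gens_subset)

end

theory Submission
  imports Defs "HOL-Library.Multiset_Order" "HOL-Library.Product_Lexorder"
begin

text \<open>The ideal of minors is shown to be the kernel of the ring homomorphism
  \<open>T\<^bsub>i,j,k\<^esub> \<mapsto> x\<^sub>i y\<^sub>j z\<^sub>k\<close>. That kernel is prime because the target, a polynomial ring over a field,
  is an integral domain (\<open>primeideal_toric_kernel\<close>). Every minor visibly maps to zero, so the
  content is the converse inclusion.

  A monomial in the variables \<open>T\<^sub>u\<close> is a finite multiset of points of \<open>D\<close>, and its image records how often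
  each value occurs in each coordinate: the margin of the multiset. A polynomial in the kernel is
  a combination of differences of monomials with equal margins. It therefore suffices to connect any
  two multisets of points of \<open>D\<close> with equal margins by swaps of a single coordinate between
  two points, all points involved lying in \<open>D\<close>, since each swap changes the monomial by a multiple of
  a minor.

  Connectedness is proved by induction on the size: it is enough to bring one common
  point into both multisets and remove it (\<open>common_point\<close>). Let \<open>l\<close> be the smallest first
  coordinate that occurs, and let \<open>jm\<close> and \<open>km\<close> be the largest second and third coordinates. The
  projection property says that the bounding rectangle of each layer of \<open>D\<close> is contained in all
  lower layers. Suppose that every layer that reaches \<open>km\<close> in the z direction also
  reaches \<open>jm\<close> in the y direction; otherwise the converse holds, because the layers decrease, and
  y and z exchange roles. A point with third coordinate \<open>km\<close> in a layer above \<open>l\<close> may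
  then swap its z coordinate with any point of the multiset in layer \<open>l\<close>, since the bounding rectangle of its layer
  contains all pairs \<open>(j, km)\<close> with \<open>j \<le> jm\<close> (\<open>pull_max_z_to_lowest_layer\<close>). Afterwards the second
  coordinate of the point with third coordinate \<open>km\<close> in layer \<open>l\<close> can be raised to the largest
  value that occurs and keeps it in \<open>D\<close> (\<open>raise_y_next_to_max_z\<close>). The resulting point depends
  on the margin only, so it is common to both multisets.\<close>
section \<open>Coordinate swaps\<close>

text \<open>Swaps of the first coordinate are omitted: the result of one, as an unordered pair of points,
  is also reached by swapping both other coordinates, and the y and z swaps alone already
  connect the multisets below.\<close>
inductive swap_equiv :: "point set \<Rightarrow> point multiset \<Rightarrow> point multiset \<Rightarrow> bool"
  for D :: "point set" where
  refl: "swap_equiv D A A"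
| sym: "swap_equiv D A B \<Longrightarrow> swap_equiv D B A"
| trans: "swap_equiv D A B \<Longrightarrow> swap_equiv D B C \<Longrightarrow> swap_equiv D A C"
| add: "swap_equiv D A B \<Longrightarrow> u \<in> D \<Longrightarrow> swap_equiv D (add_mset u A) (add_mset u B)"
| swap_y: "{(i1, j1, k1), (i2, j2, k2), (i1, j2, k1), (i2, j1, k2)} \<subseteq> D \<Longrightarrow>
    swap_equiv D {#(i1, j1, k1), (i2, j2, k2)#} {#(i1, j2, k1), (i2, j1, k2)#}"
| swap_z: "{(i1, j1, k1), (i2, j2, k2), (i1, j1, k2), (i2, j2, k1)} \<subseteq> D \<Longrightarrow>
    swap_equiv D {#(i1, j1, k1), (i2, j2, k2)#} {#(i1, j1, k2), (i2, j2, k1)#}"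

text \<open>The tags 0, 1, 2 keep the three axes apart, so that one multiset serves as the exponent of a
  monomial in the variables \<open>x\<^sub>i\<close>, \<open>y\<^sub>j\<close>, \<open>z\<^sub>k\<close>.\<close>
definition margin :: "point multiset \<Rightarrow> (nat \<times> nat) multiset" where
  "margin A = image_mset (\<lambda>(i, j, k). (0, i)) A + image_mset (\<lambda>(i, j, k). (1, j)) A +
     image_mset (\<lambda>(i, j, k). (2, k)) A"

lemma margin_empty [simp]: "margin {#} = {#}"
  by (simp add: margin_def)

lemma margin_union: "margin (A + B) = margin A + margin B"
  by (simp add: margin_def)

lemma margin_add_mset:
  "margin (add_mset (i, j, k) A) = {#(0, i), (1, j), (2, k)#} + margin A"
  by (simp add: margin_def)

lemma size_margin: "size (margin A) = 3 * size A"
  by (simp add: margin_def)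

lemma in_margin:
  "(0, i) \<in># margin A \<longleftrightarrow> (\<exists>j k. (i, j, k) \<in># A)"
  "(Suc 0, j) \<in># margin A \<longleftrightarrow> (\<exists>i k. (i, j, k) \<in># A)"
  "(2, k) \<in># margin A \<longleftrightarrow> (\<exists>i j. (i, j, k) \<in># A)"
  by (force simp: margin_def image_iff)+

lemma swap_equiv_margin: "swap_equiv D A B \<Longrightarrow> margin A = margin B"
proof (induction rule: swap_equiv.induct)
  case (add A B u)
  then show ?case by (cases u) (simp add: margin_add_mset)
qed (simp_all add: margin_add_mset add_mset_commute)

lemma swap_equiv_subset: "swap_equiv D A B \<Longrightarrow> set_mset A \<subseteq> D \<longleftrightarrow> set_mset B \<subseteq> D"
  by (induction rule: swap_equiv.induct) auto

lemma swap_equiv_union: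
  assumes "swap_equiv D A B" "set_mset C \<subseteq> D"
  shows "swap_equiv D (A + C) (B + C)"
  using assms(2) by (induction C) (auto intro: assms(1) swap_equiv.add)

section \<open>Moving a common point into two configurations\<close>

text \<open>The last clause says that the bounding rectangle of a layer lies in every lower layer. Unlike
  the projection property it mentions no maxima and is visibly symmetric in the second and third
  coordinates.\<close>
definition layered :: "point set \<Rightarrow> bool" where
  "layered D \<longleftrightarrow> (\<forall>(i, j, k)\<in>D. 1 \<le> i \<and> 1 \<le> j \<and> 1 \<le> k) \<and>
     (\<forall>i0 j0 k0 i j k. (i0, j0, k0) \<in> D \<and> 1 \<le> i \<and> i \<le> i0 \<and> 1 \<le> j \<and> j \<le> j0 \<and> 1 \<le> k \<and> k \<le> k0
        \<longrightarrow> (i, j, k) \<in> D) \<and>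
     (\<forall>i i0 j k. 1 \<le> i \<and> i < i0 \<and> (i0, j, 1) \<in> D \<and> (i0, 1, k) \<in> D \<longrightarrow> (i, j, k) \<in> D)"

lemma layeredI:
  assumes "\<And>i j k. (i, j, k) \<in> D \<Longrightarrow> 1 \<le> i \<and> 1 \<le> j \<and> 1 \<le> k"
    and "\<And>i0 j0 k0 i j k. (i0, j0, k0) \<in> D \<Longrightarrow> 1 \<le> i \<Longrightarrow> i \<le> i0 \<Longrightarrow> 1 \<le> j \<Longrightarrow> j \<le> j0 \<Longrightarrow>
      1 \<le> k \<Longrightarrow> k \<le> k0 \<Longrightarrow> (i, j, k) \<in> D"
    and "\<And>i i0 j k. 1 \<le> i \<Longrightarrow> i < i0 \<Longrightarrow> (i0, j, 1) \<in> D \<Longrightarrow> (i0, 1, k) \<in> D \<Longrightarrow> (i, j, k) \<in> D"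
  shows "layered D"
  unfolding layered_def
proof (intro conjI allI impI)
  show "\<forall>(i, j, k)\<in>D. 1 \<le> i \<and> 1 \<le> j \<and> 1 \<le> k" using assms(1) by fast
qed (elim conjE, rule assms(2,3); assumption)+

lemma layered_pos: "layered D \<Longrightarrow> (i, j, k) \<in> D \<Longrightarrow> 1 \<le> i \<and> 1 \<le> j \<and> 1 \<le> k"
  unfolding layered_def by fastforce

lemma layered_down:
  "layered D \<Longrightarrow> (i0, j0, k0) \<in> D \<Longrightarrow> 1 \<le> i \<Longrightarrow> i \<le> i0 \<Longrightarrow> 1 \<le> j \<Longrightarrow> j \<le> j0 \<Longrightarrow>
    1 \<le> k \<Longrightarrow> k \<le> k0 \<Longrightarrow> (i, j, k) \<in> D"
  unfolding layered_def by metis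

lemma layered_rectangle:
  "layered D \<Longrightarrow> 1 \<le> i \<Longrightarrow> i < i0 \<Longrightarrow> (i0, j, 1) \<in> D \<Longrightarrow> (i0, 1, k) \<in> D \<Longrightarrow> (i, j, k) \<in> D"
  unfolding layered_def by metis

lemma ferrers_pos: "ferrers_diagram D \<Longrightarrow> (i, j, k) \<in> D \<Longrightarrow> 1 \<le> i \<and> 1 \<le> j \<and> 1 \<le> k"
  unfolding ferrers_diagram_def by fastforce

lemma ferrers_down:
  "ferrers_diagram D \<Longrightarrow> (i0, j0, k0) \<in> D \<Longrightarrow> 1 \<le> i \<Longrightarrow> i \<le> i0 \<Longrightarrow> 1 \<le> j \<Longrightarrow> j \<le> j0 \<Longrightarrow>
    1 \<le> k \<Longrightarrow> k \<le> k0 \<Longrightarrow> (i, j, k) \<in> D"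
  unfolding ferrers_diagram_def by metis

lemma ferrers_fst_image:
  assumes "ferrers_diagram D"
  shows "fst ` D = {1..a_dim D}"
proof -
  have fin: "finite D" "D \<noteq> {}" using assms unfolding ferrers_diagram_def by auto
  note D = fin ferrers_pos[OF assms] ferrers_down[OF assms]
  define a where "a = Max (fst ` D)"
  have "a \<in> fst ` D" unfolding a_def using D by (intro Max_in) auto
  then obtain j k where a: "(a, j, k) \<in> D" by auto
  have "fst ` D = {1..a}"
  proof (intro equalityI subsetI)
    fix i assume "i \<in> fst ` D"
    then show "i \<in> {1..a}" using D(1,3) unfolding a_def by (auto intro!: Max_ge)
  next
    fix i assume "i \<in> {1..a}"
    then have "(i, j, k) \<in> D" using D(3)[OF a] by (intro D(4)[OF a]) auto
    then show "i \<in> fst ` D" by force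
  qed
  then show ?thesis unfolding a_dim_def by simp
qed

text \<open>The projection property speaks of adjacent layers only; the remaining lower layers follow since
  a Ferrers diagram is closed downwards.\<close>
lemma ferrers_projection_layered:
  assumes F: "ferrers_diagram D" and P: "projection_property D"
  shows "layered D"
proof -
  have fin: "finite D" using F unfolding ferrers_diagram_def by auto
  note D = fin ferrers_pos[OF F] ferrers_down[OF F]
  have "(i, j, k) \<in> D" if *: "1 \<le> i" "i < i0" "(i0, j, 1) \<in> D" "(i0, 1, k) \<in> D" for i i0 j k
  proof -
    have "i0 \<in> fst ` D" using *(3) by force
    then have "2 \<le> i0" "i0 \<le> a_dim D" using * by (auto simp: ferrers_fst_image[OF F])
    then have corner: "(i0 - 1, b_dim D i0, c_dim D i0) \<in> D"
      using P unfolding projection_property_def by blast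
    have "finite {j. (i0, j, 1) \<in> D}" "finite {k. (i0, 1, k) \<in> D}"
      using finite_vimageI[OF D(1), of "\<lambda>j. (i0, j, 1)"] finite_vimageI[OF D(1), of "\<lambda>k. (i0, 1, k)"]
      by (simp_all add: vimage_def inj_def)
    then have "j \<le> b_dim D i0" "k \<le> c_dim D i0"
      unfolding b_dim_def c_dim_def using * by (auto intro!: Max_ge)
    then show ?thesis using * D(2)[OF *(3)] D(2)[OF *(4)] by (intro D(3)[OF corner]) auto
  qed
  with ferrers_pos[OF F] ferrers_down[OF F] show ?thesis by (rule layeredI)
qed

text \<open>A point \<open>(i2, j2, km)\<close> with \<open>i2 > l\<close> shows that layer \<open>i2\<close> reaches \<open>km\<close> along z, hence by
  assumption \<open>jm\<close> along y. Its bounding rectangle, contained in layer \<open>l\<close>, then has room for any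
  \<open>(j, km)\<close> with \<open>j \<le> jm\<close>, so the z coordinates of that point and of a point of layer \<open>l\<close> can be swapped.\<close>
lemma pull_max_z_to_lowest_layer:
  assumes lay: "layered D" and A: "set_mset A \<subseteq> D"
    and l: "(0, l) \<in># margin A" "\<And>i. (0, i) \<in># margin A \<Longrightarrow> l \<le> i"
    and jm: "\<And>j. (1, j) \<in># margin A \<Longrightarrow> j \<le> jm"
    and km: "(2, km) \<in># margin A" "\<And>k. (2, k) \<in># margin A \<Longrightarrow> k \<le> km"
    and extent: "\<And>i. (i, 1, km) \<in> D \<Longrightarrow> (i, jm, 1) \<in> D"
  shows "\<exists>j A'. swap_equiv D A (add_mset (l, j, km) A')"
proof -
  obtain i2 j2 where v: "(i2, j2, km) \<in># A" using km(1) by (auto simp: in_margin)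
  obtain j k where u: "(l, j, k) \<in># A" using l(1) by (auto simp: in_margin)
  show ?thesis
  proof (cases "i2 = l")
    case True
    then have "A = add_mset (l, j2, km) (A - {#(l, j2, km)#})" using v by simp
    then show ?thesis using swap_equiv.refl by metis
  next
    case False
    have "l \<le> i2" using v l(2) by (auto simp: in_margin)
    with False have lt: "l < i2" by simp
    obtain A0 where A0: "A = add_mset (l, j, k) A0" using u by (metis insert_DiffM)
    then have "(i2, j2, km) \<in># A0" using v False by simp
    then obtain C where "A0 = add_mset (i2, j2, km) C" by (metis insert_DiffM)
    then have AC: "A = {#(l, j, k), (i2, j2, km)#} + C" using A0 by simp
    have uD: "(l, j, k) \<in> D" and vD: "(i2, j2, km) \<in> D" and CD: "set_mset C \<subseteq> D"
      using A unfolding AC by auto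
    note pos = layered_pos[OF lay uD] layered_pos[OF lay vD]
    have "j \<le> jm" "k \<le> km" using u jm km(2) by (auto simp: in_margin)
    have far: "(i2, 1, km) \<in> D" using pos by (intro layered_down[OF lay vD]) auto
    have "(i2, j, 1) \<in> D"
      using pos \<open>j \<le> jm\<close> by (intro layered_down[OF lay extent[OF far]]) auto
    then have "(l, j, km) \<in> D" using pos lt far by (intro layered_rectangle[OF lay, of l i2]) auto
    moreover have "(i2, j2, k) \<in> D" using pos \<open>k \<le> km\<close> by (intro layered_down[OF lay vD]) auto
    ultimately have "swap_equiv D A ({#(l, j, km), (i2, j2, k)#} + C)"
      unfolding AC using uD vD CD by (intro swap_equiv_union swap_equiv.swap_z) auto
    then show ?thesis by auto
  qed
qed

text \<open>Raising the second coordinate lowers that of the partner in the swap, which keeps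
  the partner in \<open>D\<close>. The opposite choice of the smallest second coordinate would fail here: it
  could push the partner out of \<open>D\<close>.\<close>
lemma raise_y_next_to_max_z:
  assumes lay: "layered D" and A: "set_mset (add_mset (l, j, km) A) \<subseteq> D"
    and jt: "(1, jt) \<in># margin (add_mset (l, j, km) A)" "(l, jt, km) \<in> D" "j \<le> jt"
  shows "\<exists>A'. swap_equiv D (add_mset (l, j, km) A) (add_mset (l, jt, km) A')"
proof (cases "j = jt")
  case True
  then show ?thesis using swap_equiv.refl by blast
next
  case False
  then obtain i k where v: "(i, jt, k) \<in># A" using jt(1) by (auto simp: in_margin)
  then obtain C where AC: "A = add_mset (i, jt, k) C" by (metis insert_DiffM)
  have uD: "(l, j, km) \<in> D" and vD: "(i, jt, k) \<in> D" and CD: "set_mset C \<subseteq> D"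
    using A unfolding AC by auto
  have "(i, j, k) \<in> D"
    using layered_pos[OF lay uD] layered_pos[OF lay vD] jt(3)
    by (intro layered_down[OF lay vD]) auto
  then have "swap_equiv D ({#(l, j, km), (i, jt, k)#} + C) ({#(l, jt, km), (i, j, k)#} + C)"
    using uD vD jt(2) CD by (intro swap_equiv_union swap_equiv.swap_y) auto
  then show ?thesis unfolding AC by auto
qed

text \<open>The common point is \<open>(l, Max J, km)\<close>, where \<open>J\<close> below is determined by \<open>D\<close> and the margin; the
  first of the two moves shows that \<open>J\<close> is nonempty.\<close>
lemma common_point_if_y_reaches_further:
  assumes lay: "layered D" and A: "set_mset A \<subseteq> D" and B: "set_mset B \<subseteq> D"
    and AB: "margin A = margin B"
    and l: "(0, l) \<in># margin A" "\<And>i. (0, i) \<in># margin A \<Longrightarrow> l \<le> i"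
    and jm: "\<And>j. (1, j) \<in># margin A \<Longrightarrow> j \<le> jm"
    and km: "(2, km) \<in># margin A" "\<And>k. (2, k) \<in># margin A \<Longrightarrow> k \<le> km"
    and extent: "\<And>i. (i, 1, km) \<in> D \<Longrightarrow> (i, jm, 1) \<in> D"
  shows "\<exists>u A' B'. swap_equiv D A (add_mset u A') \<and> swap_equiv D B (add_mset u B')"
proof -
  define J where "J = {j. (1, j) \<in># margin A \<and> (l, j, km) \<in> D}"
  have fin: "finite J"
  proof (rule finite_subset)
    show "J \<subseteq> {..jm}" using jm unfolding J_def by auto
  qed simp
  have "\<exists>X'. swap_equiv D X (add_mset (l, Max J, km) X')"
    if X: "set_mset X \<subseteq> D" "margin X = margin A" for X
  proof -
    obtain j X0 where X0: "swap_equiv D X (add_mset (l, j, km) X0)"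
      using pull_max_z_to_lowest_layer[OF lay X(1), unfolded X(2), OF l jm km extent] by blast
    let ?Y = "add_mset (l, j, km) X0"
    have YD: "set_mset ?Y \<subseteq> D" using swap_equiv_subset[OF X0] X(1) by simp
    have mY: "margin ?Y = margin A" using swap_equiv_margin[OF X0] X(2) by simp
    have "(1, j) \<in># margin ?Y" by (simp add: margin_add_mset)
    then have jJ: "j \<in> J" using YD unfolding J_def mY by simp
    then have "Max J \<in> J" using fin by (intro Max_in) auto
    then have "(1, Max J) \<in># margin ?Y" "(l, Max J, km) \<in> D" unfolding mY J_def by auto
    from raise_y_next_to_max_z[OF lay YD this Max_ge[OF fin jJ]]
    show ?thesis using X0 swap_equiv.trans by blast
  qed
  from this[OF A] this[OF B] AB show ?thesis by metis
qed

text \<open>Exchanging the last two axes transfers the previous lemma to diagrams where the layers that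
  reach \<open>jm\<close> in the y direction also reach \<open>km\<close> in the z direction.\<close>
fun flip_yz :: "point \<Rightarrow> point" where
  "flip_yz (i, j, k) = (i, k, j)"

lemma flip_yz_flip_yz [simp]: "flip_yz (flip_yz u) = u"
  by (cases u) simp

lemma flip_yz_comp [simp]: "flip_yz \<circ> flip_yz = id"
  by (simp add: fun_eq_iff)

lemma in_flip_yz_image [simp]: "(i, j, k) \<in> flip_yz ` D \<longleftrightarrow> (i, k, j) \<in> D"
  by (metis flip_yz.simps flip_yz_flip_yz image_eqI imageE)

lemma layered_flip_yz:
  assumes "layered D"
  shows "layered (flip_yz ` D)"
proof -
  note rules = layered_pos[OF assms] layered_down[OF assms] layered_rectangle[OF assms]
  have "1 \<le> i \<and> 1 \<le> j \<and> 1 \<le> k" if "(i, j, k) \<in> flip_yz ` D" for i j k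
    using that rules(1) by auto
  moreover have "(i, j, k) \<in> flip_yz ` D"
    if "(i0, j0, k0) \<in> flip_yz ` D" "1 \<le> i" "i \<le> i0" "1 \<le> j" "j \<le> j0" "1 \<le> k" "k \<le> k0"
    for i0 j0 k0 i j k
    using that rules(2)[of i0 k0 j0 i k j] by simp
  moreover have "(i, j, k) \<in> flip_yz ` D"
    if "1 \<le> i" "i < i0" "(i0, j, 1) \<in> flip_yz ` D" "(i0, 1, k) \<in> flip_yz ` D" for i i0 j k
    using that rules(3)[of i i0 k j] by simp
  ultimately show ?thesis by (rule layeredI)
qed

lemma swap_equiv_flip_yz:
  "swap_equiv D A B \<Longrightarrow>
    swap_equiv (flip_yz ` D) (image_mset flip_yz A) (image_mset flip_yz B)"
proof (induction rule: swap_equiv.induct)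
  case (swap_y i1 j1 k1 i2 j2 k2)
  then show ?case by (auto intro!: swap_equiv.swap_z)
next
  case (swap_z i1 j1 k1 i2 j2 k2)
  then show ?case by (auto intro!: swap_equiv.swap_y)
qed (auto intro: swap_equiv.intros)

lemma in_margin_flip_yz:
  "(0, i) \<in># margin (image_mset flip_yz A) \<longleftrightarrow> (0, i) \<in># margin A"
  "(Suc 0, j) \<in># margin (image_mset flip_yz A) \<longleftrightarrow> (2, j) \<in># margin A"
  "(2, k) \<in># margin (image_mset flip_yz A) \<longleftrightarrow> (Suc 0, k) \<in># margin A"
  by (simp_all add: in_margin) blast+

lemma margin_flip_yz_cong:
  assumes "margin A = margin B"
  shows "margin (image_mset flip_yz A) = margin (image_mset flip_yz B)"
proof -
  \<comment> \<open>The map \<open>f\<close> fixes tag 0 and exchanges the tags 1 and 2.\<close>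
  define f where "f = (\<lambda>(t :: nat, x :: nat). (if t = 0 then 0 else 3 - t, x))"
  have "margin (image_mset flip_yz A) = image_mset f (margin A)" for A
  proof (induction A)
    case (add u A)
    then show ?case by (cases u) (simp add: margin_add_mset f_def)
  qed simp
  then show ?thesis using assms by simp
qed

lemma common_point:
  assumes lay: "layered D" and A: "set_mset A \<subseteq> D" and B: "set_mset B \<subseteq> D"
    and AB: "margin A = margin B" and "A \<noteq> {#}"
  shows "\<exists>u A' B'. swap_equiv D A (add_mset u A') \<and> swap_equiv D B (add_mset u B')"
proof -
  have fin: "finite {x. (t, x) \<in># margin A}" for t
    using finite_vimageI[OF finite_set_mset, of "\<lambda>x. (t, x)" "margin A"]
    by (simp add: vimage_def inj_def)
  obtain i j k where "(i, j, k) \<in># A" using \<open>A \<noteq> {#}\<close> by (metis multiset_nonemptyE prod_cases3)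
  then have ne: "(0, i) \<in># margin A" "(1, j) \<in># margin A" "(2, k) \<in># margin A"
    by (auto simp: in_margin)
  define l where "l = Min {x. (0, x) \<in># margin A}"
  define jm where "jm = Max {x. (1, x) \<in># margin A}"
  define km where "km = Max {x. (2, x) \<in># margin A}"
  have l: "(0, l) \<in># margin A" "\<And>i. (0, i) \<in># margin A \<Longrightarrow> l \<le> i"
    using Min_in[OF fin[of 0]] Min_le[OF fin[of 0]] ne unfolding l_def by auto
  have jm: "(1, jm) \<in># margin A" "\<And>i. (1, i) \<in># margin A \<Longrightarrow> i \<le> jm"
    using Max_in[OF fin[of 1]] Max_ge[OF fin[of 1]] ne unfolding jm_def by auto
  have km: "(2, km) \<in># margin A" "\<And>i. (2, i) \<in># margin A \<Longrightarrow> i \<le> km"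
    using Max_in[OF fin[of 2]] Max_ge[OF fin[of 2]] ne unfolding km_def by auto
  show ?thesis
  proof (cases "\<forall>i. (i, 1, km) \<in> D \<longrightarrow> (i, jm, 1) \<in> D")
    case True
    then show ?thesis
      by (intro common_point_if_y_reaches_further[OF lay A B AB l jm(2) km]) auto
  next
    case False
    then obtain i0 where i0: "(i0, 1, km) \<in> D" "(i0, jm, 1) \<notin> D" by blast
    \<comment> \<open>The layers reaching \<open>jm\<close> and those reaching \<open>km\<close> are two initial segments of the layers, so
      one of the two families contains the other.\<close>
    have ext: "(i, 1, km) \<in> D" if "(i, jm, 1) \<in> D" for i
    proof -
      note pos = layered_pos[OF lay that] layered_pos[OF lay i0(1)]
      have "\<not> i0 \<le> i" using layered_down[OF lay that, of i0 jm 1] i0(2) pos by auto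
      then show ?thesis using pos by (intro layered_down[OF lay i0(1)]) auto
    qed
    let ?f = "image_mset flip_yz"
    have "\<exists>u A' B'. swap_equiv (flip_yz ` D) (?f A) (add_mset u A') \<and>
        swap_equiv (flip_yz ` D) (?f B) (add_mset u B')"
    proof (rule common_point_if_y_reaches_further[where l = l and jm = km and km = jm])
      show "layered (flip_yz ` D)" by (rule layered_flip_yz[OF lay])
      show "margin (?f A) = margin (?f B)" by (rule margin_flip_yz_cong[OF AB])
    qed (use A B l jm km ext in \<open>auto simp: in_margin_flip_yz\<close>)
    then obtain u A' B' where *: "swap_equiv (flip_yz ` D) (?f A) (add_mset u A')"
      "swap_equiv (flip_yz ` D) (?f B) (add_mset u B')" by blast
    have "flip_yz ` flip_yz ` D = D" by (simp add: image_comp)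
    then have "swap_equiv D A (add_mset (flip_yz u) (?f A'))"
      "swap_equiv D B (add_mset (flip_yz u) (?f B'))"
      using *[THEN swap_equiv_flip_yz] by (simp_all add: multiset.map_comp multiset.map_id0)
    then show ?thesis by blast
  qed
qed

text \<open>Removing a common point leaves margins equal, and the moves on what remains can be carried out
  in the presence of that point.\<close>
lemma swap_equiv_if_margin_eq:
  assumes lay: "layered D"
    and "set_mset A \<subseteq> D" "set_mset B \<subseteq> D" "margin A = margin B"
  shows "swap_equiv D A B"
  using assms(2-)
proof (induction "size A" arbitrary: A B rule: less_induct)
  case less
  show ?case
  proof (cases "A = {#}")
    case True
    then have "size (margin B) = 0" using less.prems(3) by simp
    then have "B = {#}" by (simp add: size_margin)
    then show ?thesis using True swap_equiv.refl by simp
  next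
    case False
    then obtain u A' B' where *: "swap_equiv D A (add_mset u A')" "swap_equiv D B (add_mset u B')"
      using common_point[OF lay less.prems] by blast
    have sub: "set_mset (add_mset u A') \<subseteq> D" "set_mset (add_mset u B') \<subseteq> D"
      using *[THEN swap_equiv_subset] less.prems by auto
    have "margin (add_mset u A') = margin (add_mset u B')"
      using *[THEN swap_equiv_margin] less.prems by simp
    then have eq: "margin A' = margin B'" by (cases u) (simp add: margin_add_mset)
    have "3 * size A = 3 * size (add_mset u A')"
      unfolding size_margin[symmetric] using swap_equiv_margin[OF *(1)] by simp
    then have "size A' < size A" by simp
    then have "swap_equiv D A' B'" using less.hyps sub eq by simp
    then have "swap_equiv D (add_mset u A') (add_mset u B')" using sub swap_equiv.add by simp
    then show ?thesis using * swap_equiv.sym swap_equiv.trans by blast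
  qed
qed

section \<open>Relabelling exponents\<close>

text \<open>When \<open>f\<close> is a homomorphism of monoids, this is the induced ring homomorphism of monoid algebras.
  An arbitrary \<open>f\<close> is allowed because \<open>push\<close> is also applied below to a choice of representatives,
  which respects addition of polynomials only.\<close>
definition push :: "('a \<Rightarrow> 'b) \<Rightarrow> ('a \<Rightarrow>\<^sub>0 'c::comm_monoid_add) \<Rightarrow> ('b \<Rightarrow>\<^sub>0 'c)" where
  "push f p = (\<Sum>m\<in>Poly_Mapping.keys p. Poly_Mapping.single (f m) (Poly_Mapping.lookup p m))"

lemma push_superset:
  assumes "finite S" "Poly_Mapping.keys p \<subseteq> S"
  shows "push f p = (\<Sum>m\<in>S. Poly_Mapping.single (f m) (Poly_Mapping.lookup p m))"
  unfolding push_def using assms by (intro sum.mono_neutral_left) (auto simp: in_keys_iff)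

lemma push_0 [simp]: "push f 0 = 0"
  by (simp add: push_def)

lemma push_single [simp]: "push f (Poly_Mapping.single m c) = Poly_Mapping.single (f m) c"
  by (simp add: push_def)

lemma push_add: "push f (p + q) = push f p + push f q"
proof -
  let ?S = "Poly_Mapping.keys p \<union> Poly_Mapping.keys q"
  have "push f (p + q) = (\<Sum>m\<in>?S. Poly_Mapping.single (f m) (Poly_Mapping.lookup (p + q) m))"
    using Poly_Mapping.keys_add[of p q] by (intro push_superset) auto
  also have "\<dots> = push f p + push f q"
    by (simp add: push_superset[of ?S] lookup_add single_add sum.distrib)
  finally show ?thesis .
qed

lemma push_sum: "push f (sum g S) = (\<Sum>s\<in>S. push f (g s))"
  by (induction S rule: infinite_finite_induct) (simp_all add: push_add)

lemma push_diff: "push f (p - q) = push f p - push f (q :: _ \<Rightarrow>\<^sub>0 'c::ab_group_add)"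
  using push_add[of f "p - q" q] by simp

lemma push_id: "push (\<lambda>m. m) p = p"
  by (rule poly_mapping_eqI)
     (auto simp: push_def lookup_sum lookup_single when_def in_keys_iff)

lemma push_push: "push g (push f p) = push (\<lambda>m. g (f m)) p"
  unfolding push_def[of f] push_def[of "\<lambda>m. g (f m)"] by (simp add: push_sum)

lemma push_mult:
  fixes p q :: "'a::monoid_add \<Rightarrow>\<^sub>0 'c::semiring_0"
  assumes "\<And>a b. f (a + b) = f a + f b"
  shows "push f (p * q) = push f p * push f q"
proof -
  have "push f (p * q) = push f (push (\<lambda>m. m) p * push (\<lambda>m. m) q)" by (simp add: push_id)
  also have "\<dots> = push f p * push f q"
    unfolding push_def[of _ p] push_def[of _ q]
    by (simp add: sum_distrib_left sum_distrib_right push_sum mult_single assms)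
  finally show ?thesis .
qed

section \<open>The minors ideal as a toric kernel\<close>

definition mset_of_expo :: "('v \<Rightarrow>\<^sub>0 nat) \<Rightarrow> 'v multiset" where
  "mset_of_expo m = Abs_multiset (Poly_Mapping.lookup m)"

lemma count_mset_of_expo [simp]: "count (mset_of_expo m) = Poly_Mapping.lookup m"
  unfolding mset_of_expo_def using finite_lookup[of m] by (intro count_Abs_multiset) simp

lemma set_mset_of_expo [simp]: "set_mset (mset_of_expo m) = Poly_Mapping.keys m"
  by (auto simp: in_keys_iff set_mset_def)

lemma mset_of_expo_add: "mset_of_expo (m + n) = mset_of_expo m + mset_of_expo n"
  by (rule multiset_eqI) (simp add: lookup_add)

lemma mset_of_expo_0 [simp]: "mset_of_expo 0 = {#}"
  by (rule multiset_eqI) simp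

lemma mset_of_expo_single [simp]: "mset_of_expo (Poly_Mapping.single u 1) = {#u#}"
  by (rule multiset_eqI) (simp add: lookup_single when_def)

definition mon :: "'v multiset \<Rightarrow> ('v, 'k::field) mpoly" where
  "mon A = (\<Prod>u\<in>#A. Var u)"

text \<open>Translates between a product of variables, on which swaps act, and the exponent of a
  monomial, which is how polynomials are stored.\<close>
lemma mon_mset_of_expo: "mon (mset_of_expo m) = Poly_Mapping.single m 1"
proof -
  define e :: "'a multiset \<Rightarrow> ('a \<Rightarrow>\<^sub>0 nat)" where "e A = (\<Sum>u\<in>#A. Poly_Mapping.single u 1)" for A
  have mon: "mon A = Poly_Mapping.single (e A) 1" for A
    by (induction A) (simp_all add: mon_def e_def Var_def mult_single)
  have "Poly_Mapping.lookup (e A) v = count A v" for A v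
    by (induction A) (simp_all add: e_def lookup_add lookup_single when_def)
  then have "e (mset_of_expo m) = m" by (intro poly_mapping_eqI) simp
  then show ?thesis by (simp add: mon)
qed

text \<open>The exponent of the image of a monomial under \<open>T\<^bsub>i,j,k\<^esub> \<mapsto> x\<^sub>i y\<^sub>j z\<^sub>k\<close>; consequently \<open>push weight\<close> is that
  homomorphism. Its target has multisets of tagged coordinates as exponents, and the
  lexicographic order of the tagged coordinates makes these a linearly ordered cancellative
  monoid, so the target has no zero divisors.\<close>
definition weight :: "(point \<Rightarrow>\<^sub>0 nat) \<Rightarrow> (nat \<times> nat) multiset" where
  "weight m = margin (mset_of_expo m)"

lemma weight_add: "weight (m + n) = weight m + weight n"
  by (simp add: weight_def mset_of_expo_add margin_union)

lemma weight_0 [simp]: "weight 0 = 0"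
  by (simp add: weight_def)

definition toric_kernel :: "point set \<Rightarrow> (point, 'k::field) mpoly set" where
  "toric_kernel D = {p \<in> carrier (mpoly_ring D). push weight p = 0}"

lemma ideal_toric_kernel: "ideal (toric_kernel D :: (point, 'k::field) mpoly set) (mpoly_ring D)"
proof -
  let ?R = "mpoly_ring D :: (point, 'k) mpoly ring"
  interpret cring ?R by (rule cring_mpoly_ring)
  have mult: "x * p \<in> toric_kernel D" if "p \<in> toric_kernel D" "x \<in> carrier ?R" for p x
    using that mpoly_mult_closed[of x D p]
    unfolding toric_kernel_def by (simp add: push_mult weight_add del: mpoly_ring_simps(1))
  show ?thesis
  proof (rule idealI)
    show "ring ?R" by (rule ring_axioms)
    show "subgroup (toric_kernel D) (add_monoid ?R)"
    proof (rule add.subgroupI)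
      show "toric_kernel D \<subseteq> carrier ?R" unfolding toric_kernel_def by blast
      have "0 \<in> toric_kernel D" by (simp add: toric_kernel_def)
      then show "toric_kernel D \<noteq> {}" by blast
    next
      fix p :: "(point, 'k) mpoly"
      assume p: "p \<in> toric_kernel D"
      then have pR: "p \<in> carrier ?R" unfolding toric_kernel_def by blast
      have neg: "- p \<in> toric_kernel D"
        using mult[OF p, of "- 1"] by simp
      have "\<ominus>\<^bsub>?R\<^esub> p = - p"
        using pR neg by (intro minus_equality) (auto simp: toric_kernel_def)
      then show "\<ominus>\<^bsub>?R\<^esub> p \<in> toric_kernel D" using neg by simp
    next
      fix p q :: "(point, 'k) mpoly"
      assume "p \<in> toric_kernel D" "q \<in> toric_kernel D"
      then show "p \<oplus>\<^bsub>?R\<^esub> q \<in> toric_kernel D"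
        using mpoly_add_closed[of p D q] unfolding toric_kernel_def
        by (simp add: push_add del: mpoly_ring_simps(1))
    qed
  qed (use mult in \<open>simp_all add: mult.commute del: mpoly_ring_simps(1)\<close>)
qed

lemma primeideal_toric_kernel:
  "primeideal (toric_kernel D :: (point, 'k::field) mpoly set) (mpoly_ring D)"
proof (rule primeidealI)
  let ?R = "mpoly_ring D :: (point, 'k) mpoly ring"
  show "ideal (toric_kernel D) ?R" by (rule ideal_toric_kernel)
  show "cring ?R" by (rule cring_mpoly_ring)
  have "push weight (1 :: (point, 'k) mpoly) = 1"
    using push_single[of weight 0 "1 :: 'k"] by simp
  then have "1 \<notin> (toric_kernel D :: (point, 'k) mpoly set)" by (simp add: toric_kernel_def)
  moreover have "1 \<in> carrier ?R" by simp
  ultimately show "carrier ?R \<noteq> toric_kernel D" by blast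
  fix p q :: "(point, 'k) mpoly"
  assume pq: "p \<in> carrier ?R" "q \<in> carrier ?R" "p \<otimes>\<^bsub>?R\<^esub> q \<in> toric_kernel D"
  then have "push weight p * push weight q = 0"
    by (simp add: toric_kernel_def push_mult weight_add del: mpoly_ring_simps(1))
  then show "p \<in> toric_kernel D \<or> q \<in> toric_kernel D"
    using pq by (auto simp: toric_kernel_def simp del: mpoly_ring_simps(1))
qed

lemma minors_gens_toric_kernel: "minors_gens D \<subseteq> toric_kernel D"
proof -
  have V: "push weight (Var u * Var v :: (point, 'k::field) mpoly) =
      Poly_Mapping.single (margin {#u, v#}) 1" for u v
    by (simp add: Var_def push_mult weight_add mult_single weight_def margin_union[symmetric]
        mset_of_expo_add add_mset_commute del: One_nat_def)
  have "push weight (I2x D u v) = 0" "push weight (I2y D u v) = 0" "push weight (I2z D u v) = 0"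
    for u v
    by (cases u; cases v; simp add: push_diff V margin_add_mset add_mset_commute)+
  then show ?thesis
    using minors_gens_subset[of D] unfolding toric_kernel_def minors_gens_def by blast
qed

lemma minors_ideal_closed:
  fixes p q :: "(point, 'k::field) mpoly"
  shows "0 \<in> (minors_ideal D :: (point, 'k) mpoly set)"
    and "p \<in> minors_ideal D \<Longrightarrow> q \<in> minors_ideal D \<Longrightarrow> p + q \<in> minors_ideal D"
    and "p \<in> minors_ideal D \<Longrightarrow> x \<in> carrier (mpoly_ring D) \<Longrightarrow> x * p \<in> minors_ideal D"
proof -
  interpret ideal "minors_ideal D :: (point, 'k) mpoly set" "mpoly_ring D"
    by (rule ideal_minors_ideal)
  show "0 \<in> (minors_ideal D :: (point, 'k) mpoly set)" using additive_subgroup.zero_closed[OF additive_subgroup_axioms] by simp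
  show "p \<in> minors_ideal D \<Longrightarrow> q \<in> minors_ideal D \<Longrightarrow> p + q \<in> minors_ideal D"
    using additive_subgroup.a_closed[OF additive_subgroup_axioms] by simp
  show "p \<in> minors_ideal D \<Longrightarrow> x \<in> carrier (mpoly_ring D) \<Longrightarrow> x * p \<in> minors_ideal D"
    using I_l_closed[of p x] by simp
qed

lemma minors_ideal_neg:
  "p \<in> minors_ideal D \<Longrightarrow> - p \<in> (minors_ideal D :: (point, 'k::field) mpoly set)"
  using minors_ideal_closed(3)[of p D "- 1"] by simp

text \<open>A single swap replaces a product of two variables by another one whose difference is a
  generator; the closure properties of an ideal match the other rules of the relation.\<close>
lemma swap_equiv_minors_ideal:
  "swap_equiv D A B \<Longrightarrow> mon A - mon B \<in> (minors_ideal D :: (point, 'k::field) mpoly set)"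
proof (induction rule: swap_equiv.induct)
  case (refl A)
  then show ?case by (simp add: minors_ideal_closed)
next
  case (sym A B)
  then show ?case using minors_ideal_neg[of "mon A - mon B"] by simp
next
  case (trans A B C)
  then show ?case using minors_ideal_closed(2)[of "mon A - mon B" D "mon B - mon C"] by simp
next
  case (add A B u)
  then show ?case
    using minors_ideal_closed(3)[OF add.IH Var_closed[OF add.hyps(2)]]
    by (simp add: mon_def right_diff_distrib)
next
  case (swap_y i1 j1 k1 i2 j2 k2)
  then have "(I2y D (i1, j1, k1) (i2, j2, k2) :: (point, 'k) mpoly) \<in> minors_gens D"
    unfolding minors_gens_def by blast
  then have "(I2y D (i1, j1, k1) (i2, j2, k2) :: (point, 'k) mpoly) \<in> minors_ideal D"
    unfolding minors_ideal_def
    using ring.genideal_self[OF cring.axioms(1)[OF cring_mpoly_ring] minors_gens_subset] by blast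
  then show ?case using swap_y by (simp add: mon_def)
next
  case (swap_z i1 j1 k1 i2 j2 k2)
  then have "(I2z D (i1, j1, k1) (i2, j2, k2) :: (point, 'k) mpoly) \<in> minors_gens D"
    unfolding minors_gens_def by blast
  then have "(I2z D (i1, j1, k1) (i2, j2, k2) :: (point, 'k) mpoly) \<in> minors_ideal D"
    unfolding minors_ideal_def
    using ring.genideal_self[OF cring.axioms(1)[OF cring_mpoly_ring] minors_gens_subset] by blast
  then show ?case using swap_z by (simp add: mon_def)
qed

text \<open>Each monomial of \<open>p\<close> is congruent modulo the minors to a representative \<open>r\<close> of its weight. Replacing
  all monomials by their representatives collects the coefficients by weight, and these sums are
  the coefficients of \<open>push weight p\<close>, which vanish.\<close>
lemma toric_kernel_subset_minors_ideal:
  assumes lay: "layered D"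
  shows "toric_kernel D \<subseteq> (minors_ideal D :: (point, 'k::field) mpoly set)"
proof
  fix p :: "(point, 'k) mpoly" assume p: "p \<in> toric_kernel D"
  define r where "r s = (SOME m. Poly_Mapping.keys m \<subseteq> D \<and> weight m = s)" for s
  have r: "Poly_Mapping.keys (r (weight m)) \<subseteq> D \<and> weight (r (weight m)) = weight m"
    if "Poly_Mapping.keys m \<subseteq> D" for m
    unfolding r_def by (rule someI[of _ m]) (simp add: that)
  have exchange: "Poly_Mapping.single m c - Poly_Mapping.single (r (weight m)) c
      \<in> (minors_ideal D :: (point, 'k) mpoly set)"
    if m: "Poly_Mapping.keys m \<subseteq> D" for m c
  proof -
    have "swap_equiv D (mset_of_expo m) (mset_of_expo (r (weight m)))"
      using r[OF m] m by (intro swap_equiv_if_margin_eq[OF lay]) (simp_all add: weight_def)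
    then have "Poly_Mapping.single m 1 - Poly_Mapping.single (r (weight m)) 1
        \<in> (minors_ideal D :: (point, 'k) mpoly set)"
      unfolding mon_mset_of_expo[symmetric] by (rule swap_equiv_minors_ideal)
    from minors_ideal_closed(3)[OF this, of "Poly_Mapping.single 0 c"]
    show ?thesis by (simp add: right_diff_distrib mult_single)
  qed
  have "push (\<lambda>m. r (weight m)) p = 0"
    using p unfolding push_push[symmetric] toric_kernel_def by simp
  then have "p = push (\<lambda>m. m) p - push (\<lambda>m. r (weight m)) p" by (simp add: push_id)
  also have "\<dots> = (\<Sum>m\<in>Poly_Mapping.keys p. Poly_Mapping.single m (Poly_Mapping.lookup p m) -
      Poly_Mapping.single (r (weight m)) (Poly_Mapping.lookup p m))"
    by (simp add: push_def sum_subtractf)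
  also have "\<dots> \<in> minors_ideal D"
  proof -
    have "sum g S \<in> minors_ideal D" if "\<forall>s\<in>S. g s \<in> minors_ideal D"
      for g :: "(point \<Rightarrow>\<^sub>0 nat) \<Rightarrow> (point, 'k) mpoly" and S
      using that
      by (induction S rule: infinite_finite_induct) (simp_all add: minors_ideal_closed)
    then show ?thesis using p exchange by (simp add: toric_kernel_def)
  qed
  finally show "p \<in> minors_ideal D" .
qed

theorem theorem5p2:
  fixes D :: "point set"
  assumes "ferrers_diagram D" and "projection_property D"
  shows "primeideal (minors_ideal D :: (point, 'k::field_char_0) mpoly set) (mpoly_ring D)"
proof -
  let ?I = "minors_ideal D :: (point, 'k) mpoly set"
  have "?I \<subseteq> toric_kernel D"
    unfolding minors_ideal_def
    by (intro ring.genideal_minimal cring.axioms(1) cring_mpoly_ring ideal_toric_kernel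
        minors_gens_toric_kernel)
  moreover have "toric_kernel D \<subseteq> ?I"
    by (intro toric_kernel_subset_minors_ideal ferrers_projection_layered assms)
  ultimately have "?I = toric_kernel D" by (rule equalityI)
  then show ?thesis by (simp only: primeideal_toric_kernel)
qed

end
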